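(* Let $I=\mathfrak{q}_1 \cap \cdots \cap \mathfrak{q}_r$ be a primary decomposition of a monomial ideal $I\subset S=\mathbb{K}[x_1,\ldots,x_n]$, and let $k\geq 1$ be an integer. (a) $\mathrm{sat}(I^{(k)}) \leq \max\{\mathrm{sat}(\mathfrak{q}_i^k) : \sqrt{\mathfrak{q}_i} \in \mathrm{Min}(I)\}$. (b) If $I$ is squarefree, then $\mathrm{sat}(I^{(k)})=k$ if $I=\mathfrak{m}$, and $\mathrm{sat}(I^{(k)})=0$ otherwise.
   Context: $\mathbb{K}$ is a field, $S=\mathbb{K}[x_1,\ldots,x_n]$ is the polynomial ring and $\mathfrak{m}=(x_1,\ldots,x_n)$. For ideals $I,J$ of $S$, $I\colon J=\{f\in S : fJ\subseteq I\}$, and $\mathfrak{m}^0=S$. The saturation number of an ideal $I\subset S$ is $\mathrm{sat}(I)=\min\{k\geq 0 : I\colon\mathfrak{m}^k=I\colon\mathfrak{m}^{k+1}\}$. $\mathrm{Min}(I)$ is the set of minimal primes of $I$. For an integer $k\geq 1$, the $k$-th symbolic power of an ideal $I$ of $S$ with minimal primes $\mathfrak{p}_1,\ldots,\mathfrak{p}_p$ is $I^{(k)}=\bigcap_{i=1}^{p}(I^kS_{\mathfrak{p}_i}\cap S)$, i.e. the intersection of the $\mathfrak{p}_i$-primary components of $I^k$ over the minimal primes $\mathfrak{p}_i$ of $I$. A monomial ideal is squarefree if it is generated by squarefree monomials.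
   Formalization: In (a) the components of the primary decomposition are required to have pairwise distinct radicals; without this (a) fails, e.g. for I = (x^10,y^5) ∩ (x^8,y^9) and k = 2. The number of variables n is at least 1. *)

theory Defs
  imports
    "HOL-Library.Poly_Mapping"
    "HOL-Computational_Algebra.Fraction_Field"
    "HOL-Algebra.Ideal_Product"
    "HOL-Algebra.Algebraic_Closure_Type"
begin

section \<open>Ideals of a commutative ring\<close>

text \<open>The ideals of a ring form the monoid \<^const>\<open>ideals_set\<close> under the ideal product, with the
  whole ring as unit element; in particular the power with exponent 0 is the whole ring.\<close>

abbreviation ideal_power :: "('a, 'b) ring_scheme \<Rightarrow> 'a set \<Rightarrow> nat \<Rightarrow> 'a set"
  where "ideal_power R I k \<equiv> I [^]\<^bsub>ideals_set R\<^esub> k"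

definition ideal_colon :: "('a, 'b) ring_scheme \<Rightarrow> 'a set \<Rightarrow> 'a set \<Rightarrow> 'a set"
  where "ideal_colon R I J = {f \<in> carrier R. \<forall>g\<in>J. f \<otimes>\<^bsub>R\<^esub> g \<in> I}"

definition ideal_radical :: "('a, 'b) ring_scheme \<Rightarrow> 'a set \<Rightarrow> 'a set"
  where "ideal_radical R I = {f \<in> carrier R. \<exists>n::nat. f [^]\<^bsub>R\<^esub> n \<in> I}"

definition primary_ideal :: "('a, 'b) ring_scheme \<Rightarrow> 'a set \<Rightarrow> bool"
  where "primary_ideal R Q \<longleftrightarrow> ideal Q R \<and> Q \<noteq> carrier R \<and>
    (\<forall>a\<in>carrier R. \<forall>b\<in>carrier R. a \<otimes>\<^bsub>R\<^esub> b \<in> Q \<longrightarrow> a \<in> Q \<or> b \<in> ideal_radical R Q)"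

definition minimal_primes :: "('a, 'b) ring_scheme \<Rightarrow> 'a set \<Rightarrow> 'a set set"
  where "minimal_primes R I = {P. primeideal P R \<and> I \<subseteq> P \<and>
    (\<forall>Q. primeideal Q R \<and> I \<subseteq> Q \<and> Q \<subseteq> P \<longrightarrow> Q = P)}"

text \<open>Following the usual convention, the components of a primary decomposition have pairwise
  distinct radicals (components with the same radical are merged). Irredundancy is not required.
  Without distinct radicals the bound on the saturation number of the symbolic powers is false:
  for \<open>I = (x^10, y^5) \<inter> (x^8, y^9)\<close> in two variables and \<open>k = 2\<close>, one has
  \<open>I^(2) = I^2\<close>, and \<open>x^17 y^8\<close> is not in \<open>I^2\<close>, so that \<open>sat(I^(2)) \<ge> 26\<close>, whereas the squares of
  the two components have saturation numbers 24 and 25.\<close>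

definition primary_decomposition ::
    "('a, 'b) ring_scheme \<Rightarrow> 'a set \<Rightarrow> nat \<Rightarrow> (nat \<Rightarrow> 'a set) \<Rightarrow> bool"
  where "primary_decomposition R I r q \<longleftrightarrow>
    (\<forall>i\<in>{1..r}. primary_ideal R (q i)) \<and>
    I = carrier R \<inter> (\<Inter>i\<in>{1..r}. q i) \<and>
    inj_on (\<lambda>i. ideal_radical R (q i)) {1..r}"


section \<open>Localization of an integral domain, inside its field of fractions\<close>

definition localization :: "'a::idom set \<Rightarrow> 'a fract ring"
  where "localization P =
    ring_of_type_algebra \<lparr>carrier := {Fract a s | a s. s \<notin> P}\<rparr>"

text \<open>The contraction to the base ring of the extension of \<open>J\<close> to the localization at \<open>P\<close>.\<close>

definition local_contraction :: "'a::idom set \<Rightarrow> 'a set \<Rightarrow> 'a set"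
  where "local_contraction P J =
    {f. Fract f 1 \<in> Idl\<^bsub>localization P\<^esub> ((\<lambda>g. Fract g 1) ` J)}"


section \<open>The polynomial ring\<close>

text \<open>The variables are the elements of a finite (nonempty) type \<open>'v\<close>. Its linear order is
  only used for the type class instance which says that the polynomials form a domain.\<close>

type_synonym ('v, 'k) mpoly = "('v \<Rightarrow>\<^sub>0 nat) \<Rightarrow>\<^sub>0 'k"

abbreviation poly_ring :: "('v::{finite, linorder}, 'k::field) mpoly ring"
  where "poly_ring \<equiv> ring_of_type_algebra"

definition monomial :: "('v \<Rightarrow>\<^sub>0 nat) \<Rightarrow> ('v, 'k::field) mpoly"
  where "monomial e = Poly_Mapping.single e 1"

definition variable :: "'v \<Rightarrow> ('v, 'k::field) mpoly"
  where "variable v = monomial (Poly_Mapping.single v 1)"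

definition max_ideal :: "('v::{finite, linorder}, 'k::field) mpoly set"
  where "max_ideal = Idl\<^bsub>poly_ring\<^esub> (range variable)"

definition monomial_ideal :: "('v::{finite, linorder}, 'k::field) mpoly set \<Rightarrow> bool"
  where "monomial_ideal I \<longleftrightarrow> (\<exists>E. I = Idl\<^bsub>poly_ring\<^esub> (monomial ` E))"

definition squarefree_monomial_ideal :: "('v::{finite, linorder}, 'k::field) mpoly set \<Rightarrow> bool"
  where "squarefree_monomial_ideal I \<longleftrightarrow>
    (\<exists>E. (\<forall>e\<in>E. \<forall>v. Poly_Mapping.lookup e v \<le> 1) \<and> I = Idl\<^bsub>poly_ring\<^esub> (monomial ` E))"

text \<open>The minimum exists for every ideal, since the polynomial ring is Noetherian.\<close>

definition sat :: "('v::{finite, linorder}, 'k::field) mpoly set \<Rightarrow> nat"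
  where "sat I = (LEAST k.
    ideal_colon poly_ring I (ideal_power poly_ring max_ideal k) =
    ideal_colon poly_ring I (ideal_power poly_ring max_ideal (k + 1)))"

definition symbolic_power ::
    "('v::{finite, linorder}, 'k::field) mpoly set \<Rightarrow> nat \<Rightarrow> ('v, 'k) mpoly set"
  where "symbolic_power I k =
    (\<Inter>P\<in>minimal_primes poly_ring I. local_contraction P (ideal_power poly_ring I k))"

end

theory Submission
  imports Defs
begin

text \<open>
  Write \<open>m\<close> for the ideal generated by the variables. If \<open>m\<close> is not a minimal prime of \<open>I\<close>, then
  every minimal prime \<open>P\<close> misses some element of \<open>m\<close>, which is a unit in the localization at \<open>P\<close>;
  hence \<open>I^(k) : m = I^(k)\<close> and the saturation number of \<open>I^(k)\<close> is 0. If \<open>m\<close> is a minimal prime of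
  the monomial ideal \<open>I\<close>, then every variable \<open>v\<close> has a power among the generators of \<open>I\<close>, for
  otherwise \<open>I\<close> would be contained in the smaller prime generated by the other variables. So \<open>m\<close>
  is the only prime over \<open>I\<close>, any primary decomposition has \<open>I\<close> as its only component, and
  \<open>I^(k) = I^k\<close>. If moreover \<open>I\<close> is squarefree, these powers are the variables themselves, so that
  \<open>I = m\<close>, and the degree shows that the saturation number of \<open>m^k\<close> is \<open>k\<close>.
\<close>

section \<open>Ideals of a commutative ring type\<close>

lemma ring_of_type_algebra_simps [simp]:
  "carrier ring_of_type_algebra = UNIV"
  "x \<otimes>\<^bsub>ring_of_type_algebra\<^esub> y = x * y"
  "\<one>\<^bsub>ring_of_type_algebra\<^esub> = 1"
  "\<zero>\<^bsub>ring_of_type_algebra\<^esub> = 0"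
  "x \<oplus>\<^bsub>ring_of_type_algebra\<^esub> y = x + y"
  by (simp_all add: ring_of_type_algebra_def)

lemma a_inv_ring_of_type_algebra [simp]:
  fixes x :: "'a::comm_ring_1"
  shows "\<ominus>\<^bsub>ring_of_type_algebra\<^esub> x = - x"
proof -
  interpret R: ring "ring_of_type_algebra :: 'a ring" ..
  show ?thesis by (rule R.minus_equality) auto
qed

lemma nat_pow_ring_of_type_algebra [simp]:
  fixes x :: "'a::comm_ring_1"
  shows "x [^]\<^bsub>ring_of_type_algebra\<^esub> (n::nat) = x ^ n"
  by (induction n) (simp_all add: mult.commute)

text \<open>Closure under negation follows from \<open>- a = (-1) * a\<close>. This turns all later
  ideal arguments into statements about \<open>+\<close> and \<open>*\<close> of the type
  class.\<close>

lemma ideal_ring_of_type_algebra_iff: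
  fixes J :: "'a::comm_ring_1 set"
  shows "ideal J ring_of_type_algebra \<longleftrightarrow>
    0 \<in> J \<and> (\<forall>a\<in>J. \<forall>b\<in>J. a + b \<in> J) \<and> (\<forall>a\<in>J. \<forall>x. x * a \<in> J)"
proof
  assume "ideal J ring_of_type_algebra"
  then interpret ideal J ring_of_type_algebra .
  show "0 \<in> J \<and> (\<forall>a\<in>J. \<forall>b\<in>J. a + b \<in> J) \<and> (\<forall>a\<in>J. \<forall>x. x * a \<in> J)"
    using additive_subgroup.zero_closed[OF additive_subgroup_axioms]
      additive_subgroup.a_closed[OF additive_subgroup_axioms] I_l_closed by simp
next
  assume J: "0 \<in> J \<and> (\<forall>a\<in>J. \<forall>b\<in>J. a + b \<in> J) \<and> (\<forall>a\<in>J. \<forall>x. x * a \<in> J)"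
  interpret R: ring "ring_of_type_algebra :: 'a ring" ..
  have "- a \<in> J" if "a \<in> J" for a
    using J that by (metis mult_minus1)
  hence "subgroup J (add_monoid ring_of_type_algebra)"
    using J by (intro R.add.subgroupI) auto
  with J show "ideal J ring_of_type_algebra"
    by (intro idealI) (auto simp: R.ring_axioms mult.commute)
qed

lemma mem_ideal_radical_iff [simp]:
  fixes J :: "'a::comm_ring_1 set"
  shows "a \<in> ideal_radical ring_of_type_algebra J \<longleftrightarrow> (\<exists>n. a ^ n \<in> J)"
  by (simp add: ideal_radical_def)

context
  fixes J :: "'a::comm_ring_1 set"
  assumes J: "ideal J ring_of_type_algebra"
begin

lemma ideal_zero_mem: "0 \<in> J"
  and ideal_add_mem: "a \<in> J \<Longrightarrow> b \<in> J \<Longrightarrow> a + b \<in> J"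
  and ideal_mult_mem: "a \<in> J \<Longrightarrow> x * a \<in> J"
  using J by (simp_all add: ideal_ring_of_type_algebra_iff)

lemma ideal_sum_mem: "(\<And>i. i \<in> A \<Longrightarrow> f i \<in> J) \<Longrightarrow> sum f A \<in> J"
  by (induction A rule: infinite_finite_induct) (auto simp: ideal_zero_mem ideal_add_mem)

lemma ideal_pow_mem_mono:
  assumes "a ^ m \<in> J" "m \<le> n"
  shows "a ^ n \<in> J"
proof -
  have "a ^ n = a ^ (n - m) * a ^ m"
    using assms(2) by (simp flip: power_add)
  thus ?thesis using assms(1) by (simp add: ideal_mult_mem)
qed

text \<open>For sums this is the binomial theorem: in every term of \<open>(a + b) ^ (m + n)\<close>
  either \<open>a\<close> occurs with exponent at least \<open>m\<close> or \<open>b\<close> with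
  exponent at least \<open>n\<close>.\<close>

lemma ideal_radical_ideal: "ideal (ideal_radical ring_of_type_algebra J) ring_of_type_algebra"
  unfolding ideal_ring_of_type_algebra_iff
proof (intro conjI ballI allI)
  have "0 ^ 1 \<in> J" using ideal_zero_mem by simp
  thus "0 \<in> ideal_radical ring_of_type_algebra J"
    unfolding mem_ideal_radical_iff by blast
next
  fix a b assume "a \<in> ideal_radical ring_of_type_algebra J" "b \<in> ideal_radical ring_of_type_algebra J"
  then obtain m n where mn: "a ^ m \<in> J" "b ^ n \<in> J"
    unfolding mem_ideal_radical_iff by blast
  have "of_nat ((m + n) choose i) * a ^ i * b ^ (m + n - i) \<in> J" for i
  proof (cases "m \<le> i")
    case True
    hence "of_nat ((m + n) choose i) * b ^ (m + n - i) * a ^ i \<in> J"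
      by (intro ideal_mult_mem ideal_pow_mem_mono[OF mn(1)])
    thus ?thesis by (simp add: ac_simps)
  next
    case False
    thus ?thesis by (intro ideal_mult_mem ideal_pow_mem_mono[OF mn(2)]) auto
  qed
  hence "(a + b) ^ (m + n) \<in> J"
    unfolding binomial_ring by (intro ideal_sum_mem) auto
  thus "a + b \<in> ideal_radical ring_of_type_algebra J"
    unfolding mem_ideal_radical_iff by blast
next
  fix a x assume "a \<in> ideal_radical ring_of_type_algebra J"
  then obtain n where "a ^ n \<in> J"
    unfolding mem_ideal_radical_iff by blast
  hence "(x * a) ^ n \<in> J" by (simp add: power_mult_distrib ideal_mult_mem)
  thus "x * a \<in> ideal_radical ring_of_type_algebra J"
    unfolding mem_ideal_radical_iff by blast
qed

end

lemma ideal_eq_UNIV_iff: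
  fixes J :: "'a::comm_ring_1 set"
  assumes "ideal J ring_of_type_algebra"
  shows "J = UNIV \<longleftrightarrow> 1 \<in> J"
  using ideal_mult_mem[OF assms, of 1] by auto

lemma genideal_ring_of_type_algebra_ideal:
  fixes A :: "'a::comm_ring_1 set"
  shows "ideal (Idl\<^bsub>ring_of_type_algebra\<^esub> A) ring_of_type_algebra"
  using ring.genideal_ideal[OF ring_from_type_algebra] by auto

lemma ideal_power_0 [simp]: "ideal_power ring_of_type_algebra J 0 = UNIV"
  by (simp add: ideals_set_def)

lemma ideal_power_Suc [simp]:
  "ideal_power ring_of_type_algebra J (Suc n) =
     ideal_prod ring_of_type_algebra (ideal_power ring_of_type_algebra J n) J"
  by (simp add: ideals_set_def)

lemma ideal_power_ideal:
  fixes J :: "'a::comm_ring_1 set"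
  assumes "ideal J ring_of_type_algebra"
  shows "ideal (ideal_power ring_of_type_algebra J n) ring_of_type_algebra"
proof (induction n)
  case 0
  show ?case unfolding ideal_power_0 by (simp add: ideal_ring_of_type_algebra_iff)
next
  case (Suc n)
  thus ?case
    by (simp del: nat_pow_Suc add: ring.ideal_prod_is_ideal[OF ring_from_type_algebra] assms)
qed

lemma power_mem_ideal_power:
  fixes J :: "'a::comm_ring_1 set"
  assumes "a \<in> J"
  shows "a ^ n \<in> ideal_power ring_of_type_algebra J n"
proof (induction n)
  case (Suc n)
  have "a ^ Suc n = a ^ n \<otimes>\<^bsub>ring_of_type_algebra\<^esub> a" by simp
  thus ?case unfolding ideal_power_Suc using Suc assms by (metis ideal_prod.prod)
qed (simp del: nat_pow_0)

lemma ideal_power_1 [simp]: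
  fixes J :: "'a::comm_ring_1 set"
  assumes "ideal J ring_of_type_algebra"
  shows "ideal_power ring_of_type_algebra J 1 = J"
proof -
  interpret R: cring "ring_of_type_algebra :: 'a ring" ..
  interpret S: comm_monoid "ideals_set (ring_of_type_algebra :: 'a ring)"
    by (rule R.ideals_set_is_comm_monoid)
  show ?thesis using S.nat_pow_eone[of J] assms by (simp add: ideals_set_def)
qed

lemma mult_mem_ideal_power_add:
  fixes J :: "'a::comm_ring_1 set"
  assumes "ideal J ring_of_type_algebra"
    and "a \<in> ideal_power ring_of_type_algebra J m" "b \<in> ideal_power ring_of_type_algebra J n"
  shows "a * b \<in> ideal_power ring_of_type_algebra J (m + n)"
proof -
  interpret R: cring "ring_of_type_algebra :: 'a ring" ..
  interpret S: comm_monoid "ideals_set (ring_of_type_algebra :: 'a ring)"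
    by (rule R.ideals_set_is_comm_monoid)
  have "J \<in> carrier (ideals_set ring_of_type_algebra)"
    using assms(1) by (simp add: ideals_set_def)
  hence "ideal_power ring_of_type_algebra J (m + n) =
    ideal_prod ring_of_type_algebra (ideal_power ring_of_type_algebra J m)
      (ideal_power ring_of_type_algebra J n)"
    using S.nat_pow_mult[of J m n] unfolding ideals_set_def by simp
  thus ?thesis
    using ideal_prod.prod[OF assms(2,3), of ring_of_type_algebra] by simp
qed

lemma ideal_power_antimono:
  fixes J :: "'a::comm_ring_1 set"
  assumes "ideal J ring_of_type_algebra" "m \<le> n"
  shows "ideal_power ring_of_type_algebra J n \<subseteq> ideal_power ring_of_type_algebra J m"
  using assms(2)
proof (induction n rule: dec_induct)
  case (step n)
  thus ?case unfolding ideal_power_Suc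
    using ring.ideal_prod_inter[OF ring_from_type_algebra ideal_power_ideal[OF assms(1)] assms(1), of n]
    by blast
qed simp

lemma primeideal_ring_of_type_algebra_iff:
  fixes P :: "'a::comm_ring_1 set"
  shows "primeideal P ring_of_type_algebra \<longleftrightarrow>
    ideal P ring_of_type_algebra \<and> 1 \<notin> P \<and> (\<forall>a b. a * b \<in> P \<longrightarrow> a \<in> P \<or> b \<in> P)"
proof
  assume P: "primeideal P ring_of_type_algebra"
  then interpret primeideal P ring_of_type_algebra .
  show "ideal P ring_of_type_algebra \<and> 1 \<notin> P \<and> (\<forall>a b. a * b \<in> P \<longrightarrow> a \<in> P \<or> b \<in> P)"
    using I_notcarr I_prime ideal_axioms ideal_eq_UNIV_iff[OF ideal_axioms] by auto
next
  assume "ideal P ring_of_type_algebra \<and> 1 \<notin> P \<and> (\<forall>a b. a * b \<in> P \<longrightarrow> a \<in> P \<or> b \<in> P)"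
  thus "primeideal P ring_of_type_algebra"
    by (intro primeidealI) auto
qed

lemma primeideal_power_mem:
  fixes P :: "'a::comm_ring_1 set"
  assumes "primeideal P ring_of_type_algebra" "a ^ n \<in> P"
  shows "a \<in> P"
  using assms(2) assms(1) by (induction n) (auto simp: primeideal_ring_of_type_algebra_iff)

section \<open>Contraction from a localization\<close>

text \<open>Removes fractions from the definition of symbolic powers. The fractions with numerator
  in \<open>J\<close> and denominator outside \<open>P\<close> form an ideal of the localization, so
  they contain the extension of \<open>J\<close>; clearing denominators gives one inclusion. The
  other one is the identity \<open>f / 1 = (1 / s) * (s * f / 1)\<close>.\<close>

lemma local_contraction_eq:
  fixes P J :: "'a::idom set"
  assumes P: "primeideal P ring_of_type_algebra" and J: "ideal J ring_of_type_algebra"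
  shows "local_contraction P J = {f. \<exists>s. s \<notin> P \<and> s * f \<in> J}"
proof -
  interpret F: cring "ring_of_type_algebra :: 'a fract ring" ..
  let ?C = "{Fract a s | a s. s \<notin> P}"
  let ?L = "localization P"
  have mult: "s * t \<notin> P" if "s \<notin> P" "t \<notin> P" for s t
    using P that by (auto simp: primeideal_ring_of_type_algebra_iff)
  have zero: "s \<noteq> 0" if "s \<notin> P" for s
    using P that by (auto simp: primeideal_ring_of_type_algebra_iff ideal_ring_of_type_algebra_iff)
  have oneP: "1 \<notin> P" using P by (simp add: primeideal_ring_of_type_algebra_iff)
  \<comment> \<open>Since \<open>P\<close> is prime, its complement is closed under products and
    avoids 0, so sums and products of fractions again have admissible denominators.\<close>
  have "subring ?C ring_of_type_algebra"
  proof (rule F.subringI)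
    show "\<one>\<^bsub>ring_of_type_algebra\<^esub> \<in> ?C"
      using oneP by (auto simp: One_fract_def)
  next
    fix h assume "h \<in> ?C"
    then obtain a s where "h = Fract a s" "s \<notin> P" by auto
    hence "\<ominus>\<^bsub>ring_of_type_algebra\<^esub> h = Fract (- a) s" "s \<notin> P" by simp_all
    thus "\<ominus>\<^bsub>ring_of_type_algebra\<^esub> h \<in> ?C" by blast
  next
    fix h1 h2 assume "h1 \<in> ?C" "h2 \<in> ?C"
    then obtain a s b t where "h1 = Fract a s" "h2 = Fract b t" "s \<notin> P" "t \<notin> P" by auto
    thus "h1 \<otimes>\<^bsub>ring_of_type_algebra\<^esub> h2 \<in> ?C" "h1 \<oplus>\<^bsub>ring_of_type_algebra\<^esub> h2 \<in> ?C"
      using mult[of s t] zero by auto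
  qed auto
  hence L: "ring ?L"
    unfolding localization_def by (rule F.subring_is_ring)
  interpret L: ring ?L by (rule L)
  have L_simps: "carrier ?L = ?C" "\<zero>\<^bsub>?L\<^esub> = 0" "x \<oplus>\<^bsub>?L\<^esub> y = x + y" "x \<otimes>\<^bsub>?L\<^esub> y = x * y" for x y
    by (simp_all add: localization_def)
  let ?E = "{Fract a s | a s. a \<in> J \<and> s \<notin> P}"
  have E_add: "x + y \<in> ?E" if xy: "x \<in> ?E" "y \<in> ?E" for x y
  proof -
    obtain a s b t where *: "x = Fract a s" "y = Fract b t" "s \<notin> P" "t \<notin> P" "a \<in> J" "b \<in> J"
      using xy by auto
    have "a * t + b * s \<in> J"
      using * J by (metis ideal_add_mem ideal_mult_mem mult.commute)
    thus ?thesis using * mult[of s t] zero by auto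
  qed
  have E_mult: "x * y \<in> ?E" if xy: "x \<in> ?C" "y \<in> ?E" for x y
  proof -
    obtain a s b t where *: "x = Fract a s" "y = Fract b t" "s \<notin> P" "t \<notin> P" "b \<in> J"
      using xy by auto
    thus ?thesis using mult[of s t] ideal_mult_mem[OF J] by auto
  qed
  have E_minus: "\<ominus>\<^bsub>?L\<^esub> x \<in> ?E" if "x \<in> ?E" for x
  proof -
    have x: "x \<in> ?C" using that by auto
    \<comment> \<open>The additive inverse of \<open>?L\<close> is taken relative to its carrier; it
      agrees with negation in the fraction field once \<open>- x\<close> is known to lie in that
      carrier.\<close>
    have "- 1 \<in> ?C"
      using oneP by (auto simp: One_fract_def)
    hence *: "- x \<in> ?E" using E_mult[of "-1" x] that by simp
    hence "- x \<in> ?C" by auto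
    hence "\<ominus>\<^bsub>?L\<^esub> x = - x" using x by (intro L.minus_equality) (auto simp: L_simps)
    with * show ?thesis by simp
  qed
  have "0 \<in> ?E"
    using ideal_zero_mem[OF J] oneP by (auto simp: Zero_fract_def)
  hence "subgroup ?E (add_monoid ?L)"
    using E_add E_minus by (intro L.add.subgroupI) (auto simp: L_simps)
  hence E: "ideal ?E ?L"
  proof (intro idealI L)
    fix x y assume "x \<in> ?E" "y \<in> carrier ?L"
    thus "y \<otimes>\<^bsub>?L\<^esub> x \<in> ?E" "x \<otimes>\<^bsub>?L\<^esub> y \<in> ?E"
      using E_mult[of y x] unfolding L_simps by (simp_all add: mult.commute)
  qed
  show ?thesis
  proof (intro equalityI subsetI)
    fix f assume "f \<in> local_contraction P J"
    hence "Fract f 1 \<in> Idl\<^bsub>?L\<^esub> ((\<lambda>g. Fract g 1) ` J)"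
      by (simp add: local_contraction_def)
    moreover have "(\<lambda>g. Fract g 1) ` J \<subseteq> ?E" using oneP by auto
    ultimately have "Fract f 1 \<in> ?E" using L.genideal_minimal[OF E] by blast
    then obtain a s where "Fract f 1 = Fract a s" "a \<in> J" "s \<notin> P" by auto
    moreover from this have "s * f = a" using zero by (simp add: eq_fract mult.commute)
    ultimately show "f \<in> {f. \<exists>s. s \<notin> P \<and> s * f \<in> J}" by auto
  next
    fix f assume "f \<in> {f. \<exists>s. s \<notin> P \<and> s * f \<in> J}"
    then obtain s where s: "s \<notin> P" "s * f \<in> J" by auto
    have "Fract f 1 = Fract 1 s \<otimes>\<^bsub>?L\<^esub> Fract (s * f) 1"
      using s zero by (simp add: L_simps eq_fract)
    moreover have "Fract 1 s \<in> carrier ?L" using s by (auto simp: L_simps)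
    ultimately have "Fract f 1 \<in> K" if "ideal K ?L" "(\<lambda>g. Fract g 1) ` J \<subseteq> K" for K
      using ideal.I_l_closed[OF that(1)] that(2) s(2) by auto
    thus "f \<in> local_contraction P J"
      by (auto simp: local_contraction_def genideal_def)
  qed
qed


section \<open>Ideals of the polynomial ring\<close>

text \<open>This is the ideal generated by the variables in \<open>A\<close>, described through
  exponents so that membership can be tested term by term.\<close>

definition vars_ideal :: "'v set \<Rightarrow> ('v::{finite, linorder}, 'k::field) mpoly set"
  where "vars_ideal A =
    {f. \<forall>e\<in>Poly_Mapping.keys f. \<exists>v\<in>A. Poly_Mapping.lookup e v \<noteq> 0}"

lemma keys_monomial [simp]: "Poly_Mapping.keys (monomial e) = {e}"
  by (simp add: monomial_def)

lemma monomial_mem_vars_ideal_iff: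
  "monomial e \<in> vars_ideal A \<longleftrightarrow> (\<exists>v\<in>A. Poly_Mapping.lookup e v \<noteq> 0)"
  by (simp add: vars_ideal_def)

lemma variable_mem_vars_ideal_iff: "variable v \<in> vars_ideal A \<longleftrightarrow> v \<in> A"
  by (auto simp: variable_def monomial_mem_vars_ideal_iff lookup_single when_def)

lemma monomial_mult: "monomial (d + e) = monomial d * monomial e"
  by (simp add: monomial_def mult_single)

lemma variable_power: "variable v ^ n = monomial (Poly_Mapping.single v n)"
proof (induction n)
  case 0
  show ?case by (simp add: monomial_def)
next
  case (Suc n)
  thus ?case using single_add[of v 1 n]
    by (simp add: variable_def monomial_mult)
qed

lemma sum_keys_single: "(\<Sum>e\<in>Poly_Mapping.keys f. Poly_Mapping.single e (Poly_Mapping.lookup f e)) = f"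
  by (rule poly_mapping_eqI) (simp add: lookup_sum lookup_single when_def in_keys_iff)

lemma vars_ideal_ideal: "ideal (vars_ideal A) poly_ring"
  unfolding ideal_ring_of_type_algebra_iff
proof (intro conjI ballI allI)
  show "0 \<in> vars_ideal A" by (simp add: vars_ideal_def)
next
  fix f g :: "('a, 'b) mpoly" assume "f \<in> vars_ideal A" "g \<in> vars_ideal A"
  thus "f + g \<in> vars_ideal A"
    using keys_add[of f g] by (auto simp: vars_ideal_def)
next
  fix f g :: "('a, 'b) mpoly" assume "f \<in> vars_ideal A"
  hence "\<exists>v\<in>A. Poly_Mapping.lookup (a + b) v \<noteq> 0" if "b \<in> Poly_Mapping.keys f" for a b
    using that by (auto simp: vars_ideal_def lookup_add)
  thus "g * f \<in> vars_ideal A"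
    using keys_mult[of g f] unfolding vars_ideal_def by blast
qed

text \<open>Setting the variables in \<open>A\<close> to 0 maps onto polynomials in the remaining
  variables, which form a domain, and the kernel is \<open>vars_ideal A\<close>.\<close>

lemma vars_ideal_prime: "primeideal (vars_ideal A :: ('v::{finite, linorder}, 'k::field) mpoly set) poly_ring"
  unfolding primeideal_ring_of_type_algebra_iff
proof (intro conjI allI impI vars_ideal_ideal)
  show "1 \<notin> (vars_ideal A :: ('v, 'k) mpoly set)"
    by (auto simp: vars_ideal_def)
next
  fix f g :: "('v, 'k) mpoly" assume fg: "f * g \<in> vars_ideal A"
  \<comment> \<open>\<open>free\<close> marks the exponents without variables from \<open>A\<close>,
    and \<open>\<rho>\<close> keeps exactly the free terms, that is, it substitutes 0 for the
    variables in \<open>A\<close>.\<close>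
  define free where "free e \<longleftrightarrow> (\<forall>v\<in>A. Poly_Mapping.lookup e v = 0)" for e :: "'v \<Rightarrow>\<^sub>0 nat"
  define \<rho> where "\<rho> h = (\<Sum>e\<in>Poly_Mapping.keys h \<inter> Collect free.
      Poly_Mapping.single e (Poly_Mapping.lookup h e))" for h :: "('v, 'k) mpoly"
  have lookup_\<rho>: "Poly_Mapping.lookup (\<rho> h) e = (if free e then Poly_Mapping.lookup h e else 0)" for h e
    by (auto simp: \<rho>_def lookup_sum lookup_single when_def in_keys_iff)
  have diff: "h - \<rho> h \<in> vars_ideal A" for h
    by (auto simp: vars_ideal_def in_keys_iff lookup_minus lookup_\<rho> free_def split: if_splits)
  have keys_\<rho>: "free e" if "e \<in> Poly_Mapping.keys (\<rho> h)" for e h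
    using that by (auto simp: in_keys_iff lookup_\<rho> split: if_splits)
  have "\<rho> f * \<rho> g = f * g + (- g) * (f - \<rho> f) + (- \<rho> f) * (g - \<rho> g)"
    by (simp add: algebra_simps)
  also have "\<dots> \<in> vars_ideal A"
    by (intro ideal_add_mem[OF vars_ideal_ideal] ideal_mult_mem[OF vars_ideal_ideal] fg diff)
  finally have mem: "\<rho> f * \<rho> g \<in> vars_ideal A" .
  \<comment> \<open>All terms of the product are free, while membership in
    \<open>vars_ideal A\<close> forbids free terms. So the product is 0, and one factor vanishes
    because polynomials form a domain.\<close>
  have "free e" if "e \<in> Poly_Mapping.keys (\<rho> f * \<rho> g)" for e
    using that keys_mult[of "\<rho> f" "\<rho> g"] keys_\<rho> by (fastforce simp: free_def lookup_add)
  with mem have "Poly_Mapping.keys (\<rho> f * \<rho> g) = {}"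
    unfolding vars_ideal_def free_def by fastforce
  hence "\<rho> f = 0 \<or> \<rho> g = 0" by simp
  thus "f \<in> vars_ideal A \<or> g \<in> vars_ideal A"
    using diff[of f] diff[of g] by auto
qed

section \<open>The maximal ideal of the variables\<close>

lemma max_ideal_ideal: "ideal max_ideal poly_ring"
  unfolding max_ideal_def by (rule genideal_ring_of_type_algebra_ideal)

lemma variable_mem_max_ideal: "variable v \<in> max_ideal"
  by (auto simp: max_ideal_def genideal_def)

lemma max_ideal_subset_iff:
  assumes "ideal J poly_ring"
  shows "max_ideal \<subseteq> J \<longleftrightarrow> (\<forall>v. variable v \<in> J)"
  using assms variable_mem_max_ideal unfolding max_ideal_def genideal_def by blast

text \<open>A term with a nonzero exponent at \<open>v\<close> is a multiple of
  \<open>variable v\<close>, and a polynomial is the sum of its terms.\<close>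

lemma max_ideal_eq: "max_ideal = vars_ideal UNIV"
proof
  show "max_ideal \<subseteq> vars_ideal UNIV"
    by (simp add: max_ideal_subset_iff vars_ideal_ideal variable_mem_vars_ideal_iff)
next
  show "(vars_ideal UNIV :: ('v::{finite, linorder}, 'k::field) mpoly set) \<subseteq> max_ideal"
  proof
    fix f :: "('v, 'k) mpoly" assume f: "f \<in> vars_ideal UNIV"
    have "Poly_Mapping.single e c \<in> max_ideal" if e: "e \<in> Poly_Mapping.keys f" for e and c :: 'k
    proof -
      obtain v where v: "Poly_Mapping.lookup e v \<noteq> 0"
        using f e by (auto simp: vars_ideal_def)
      hence "e = (e - Poly_Mapping.single v 1) + Poly_Mapping.single v 1"
        by (intro poly_mapping_eqI) (auto simp: lookup_add lookup_minus lookup_single when_def)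
      hence "Poly_Mapping.single e c = Poly_Mapping.single (e - Poly_Mapping.single v 1) c * variable v"
        by (simp add: variable_def monomial_def mult_single)
      thus ?thesis
        by (simp add: ideal_mult_mem[OF max_ideal_ideal] variable_mem_max_ideal)
    qed
    hence "(\<Sum>e\<in>Poly_Mapping.keys f. Poly_Mapping.single e (Poly_Mapping.lookup f e)) \<in> max_ideal"
      by (intro ideal_sum_mem[OF max_ideal_ideal])
    thus "f \<in> max_ideal" by (simp add: sum_keys_single)
  qed
qed

lemma mem_max_ideal_iff: "f \<in> max_ideal \<longleftrightarrow> Poly_Mapping.lookup f 0 = 0"
proof -
  have "(\<exists>v. Poly_Mapping.lookup e v \<noteq> 0) \<longleftrightarrow> e \<noteq> 0" for e :: "'a \<Rightarrow>\<^sub>0 nat"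
    by (auto intro: poly_mapping_eqI)
  hence "f \<in> max_ideal \<longleftrightarrow> 0 \<notin> Poly_Mapping.keys f"
    unfolding max_ideal_eq vars_ideal_def by (simp only: bex_UNIV mem_Collect_eq) blast
  thus ?thesis by (simp add: in_keys_iff)
qed

lemma max_ideal_prime: "primeideal max_ideal poly_ring"
  by (simp add: max_ideal_eq vars_ideal_prime)

text \<open>Modulo \<open>max_ideal\<close> a polynomial equals its constant term, which is nonzero
  for \<open>s\<close>; its inverse serves as \<open>u\<close>.\<close>

lemma unit_mod_max_ideal:
  assumes "s \<notin> max_ideal"
  obtains u where "1 - u * s \<in> max_ideal"
proof
  let ?c = "Poly_Mapping.lookup s 0"
  let ?u = "Poly_Mapping.single 0 (inverse ?c) :: ('a, 'b) mpoly"
  have "s - Poly_Mapping.single 0 ?c \<in> max_ideal"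
    by (simp add: mem_max_ideal_iff lookup_minus)
  hence "(- ?u) * (s - Poly_Mapping.single 0 ?c) \<in> max_ideal"
    by (rule ideal_mult_mem[OF max_ideal_ideal])
  moreover have "?c \<noteq> 0" using assms by (simp add: mem_max_ideal_iff)
  hence "?u * Poly_Mapping.single 0 ?c = 1" by (simp add: mult_single)
  ultimately show "1 - ?u * s \<in> max_ideal" by (simp add: algebra_simps)
qed

text \<open>An element \<open>s\<close> of \<open>J\<close> outside \<open>max_ideal\<close> is
  invertible modulo \<open>max_ideal\<close>, which puts \<open>1 = (1 - u * s) + u * s\<close> into
  \<open>J\<close>.\<close>

lemma max_ideal_maximal:
  assumes J: "ideal J poly_ring" and "max_ideal \<subseteq> J" "1 \<notin> J"
  shows "J = max_ideal"
proof (rule ccontr)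
  assume "J \<noteq> max_ideal"
  then obtain s where s: "s \<in> J" "s \<notin> max_ideal" using assms by blast
  then obtain u where "1 - u * s \<in> J" using unit_mod_max_ideal[of s] assms(2) by blast
  hence "(1 - u * s) + u * s \<in> J" by (intro ideal_add_mem[OF J] ideal_mult_mem[OF J] s(1))
  with assms(3) show False by simp
qed

lemma max_ideal_mem_minimal_primes: "max_ideal \<in> minimal_primes poly_ring max_ideal"
  unfolding minimal_primes_def using max_ideal_prime by blast

lemma variable_power_mem_if_max_ideal_minimal:
  fixes E :: "('v::{finite, linorder} \<Rightarrow>\<^sub>0 nat) set"
  assumes "(max_ideal :: ('v, 'k::field) mpoly set) \<in>
    minimal_primes poly_ring (Idl\<^bsub>poly_ring\<^esub> (monomial ` E))"
  shows "\<exists>n. Poly_Mapping.single v n \<in> E"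
proof (rule ccontr)
  assume no_power: "\<nexists>n. Poly_Mapping.single v n \<in> E"
  let ?P = "vars_ideal (- {v}) :: ('v, 'k) mpoly set"
  have "monomial e \<in> ?P" if "e \<in> E" for e
  proof (rule ccontr)
    assume "monomial e \<notin> ?P"
    \<comment> \<open>A monomial outside \<open>?P\<close> involves no variable other than
      \<open>v\<close>, so it is a power of \<open>v\<close>, possibly with exponent 0.\<close>
    hence "e = Poly_Mapping.single v (Poly_Mapping.lookup e v)"
      by (intro poly_mapping_eqI) (auto simp: monomial_mem_vars_ideal_iff lookup_single when_def)
    with that no_power show False by metis
  qed
  hence "Idl\<^bsub>poly_ring\<^esub> (monomial ` E) \<subseteq> ?P"
    using vars_ideal_ideal by (auto simp: genideal_def)
  moreover have "?P \<subseteq> max_ideal"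
    by (auto simp: max_ideal_eq vars_ideal_def)
  ultimately have "?P = max_ideal"
    using assms vars_ideal_prime unfolding minimal_primes_def by blast
  thus False using variable_mem_max_ideal[of v] variable_mem_vars_ideal_iff[of v "- {v}"] by auto
qed

text \<open>Modulo \<open>J\<close>, an element outside of \<open>max_ideal\<close> is a unit plus a nilpotent element, hence
  a unit.\<close>

lemma mem_if_mult_mem_and_radical_max_ideal:
  assumes J: "ideal J poly_ring" and rad: "max_ideal \<subseteq> ideal_radical poly_ring J"
    and s: "s \<notin> max_ideal" "s * f \<in> J"
  shows "f \<in> J"
proof -
  obtain u where "1 - u * s \<in> max_ideal" using s(1) unit_mod_max_ideal by blast
  then obtain n where n: "(1 - u * s) ^ n \<in> J"
    using subsetD[OF rad] unfolding mem_ideal_radical_iff by blast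
  define t where "t = 1 - u * s"
  \<comment> \<open>The geometric sum shows that \<open>1 - t = u * s\<close> divides
    \<open>1 - t ^ n\<close>, so the first summand is a multiple of \<open>s * f\<close>; the second
    is a multiple of \<open>t ^ n\<close>.\<close>
  have "f = (1 - t ^ n) * f + f * t ^ n" by (simp add: algebra_simps)
  moreover have "(1 - t ^ n) * f = ((\<Sum>i<n. t ^ i) * u) * (s * f)"
    by (simp add: one_diff_power_eq t_def ac_simps)
  moreover have "((\<Sum>i<n. t ^ i) * u) * (s * f) + f * t ^ n \<in> J"
    using n unfolding t_def
    by (rule ideal_add_mem[OF J ideal_mult_mem[OF J s(2)] ideal_mult_mem[OF J]])
  ultimately show ?thesis by metis
qed


section \<open>Saturation numbers\<close>

lemma sat_eq_0I:
  assumes "\<And>f. (\<And>g. g \<in> max_ideal \<Longrightarrow> f * g \<in> J) \<Longrightarrow> f \<in> J"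
  shows "sat J = 0"
proof -
  have "ideal_colon poly_ring J (ideal_power poly_ring max_ideal 0) =
        ideal_colon poly_ring J (ideal_power poly_ring max_ideal (0 + 1))"
  proof (intro equalityI subsetI)
    fix f assume f: "f \<in> ideal_colon poly_ring J (ideal_power poly_ring max_ideal (0 + 1))"
    \<comment> \<open>The colon by the power with exponent 0 asks for all multiples
      \<open>f * g\<close> to lie in \<open>J\<close>. The assumption is applied to each of them,
      since \<open>g * h\<close> stays in \<open>max_ideal\<close>.\<close>
    have "f * g \<in> J" for g
    proof (rule assms)
      fix h assume "h \<in> (max_ideal :: ('a, 'b) mpoly set)"
      hence "g * h \<in> max_ideal" by (rule ideal_mult_mem[OF max_ideal_ideal])
      hence "f * (g * h) \<in> J"
        using f unfolding add_0 ideal_power_1[OF max_ideal_ideal] by (simp add: ideal_colon_def)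
      thus "f * g * h \<in> J" by (simp add: mult.assoc)
    qed
    thus "f \<in> ideal_colon poly_ring J (ideal_power poly_ring max_ideal 0)"
      by (simp add: ideal_colon_def)
  qed (auto simp: ideal_colon_def simp del: nat_pow_0 nat_pow_Suc)
  thus ?thesis unfolding sat_def by (rule Least_eq_0)
qed

definition total_degree :: "('v::finite \<Rightarrow>\<^sub>0 nat) \<Rightarrow> nat"
  where "total_degree e = (\<Sum>v\<in>UNIV. Poly_Mapping.lookup e v)"

text \<open>Degrees add under multiplication, and each of the \<open>k\<close> factors from
  \<open>max_ideal\<close> contributes at least one variable to every term. The inner induction
  follows the generation of an ideal product by products and sums.\<close>

lemma total_degree_ge_if_mem_max_ideal_power:
  assumes "f \<in> ideal_power poly_ring max_ideal k" "e \<in> Poly_Mapping.keys f"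
  shows "k \<le> total_degree e"
  using assms
proof (induction k arbitrary: f e)
  case (Suc k)
  from Suc.prems(1)
  have "f \<in> ideal_prod poly_ring (ideal_power poly_ring max_ideal k) max_ideal"
    unfolding ideal_power_Suc .
  thus ?case using Suc.prems(2)
  proof (induction arbitrary: e)
    case (prod g h)
    then obtain a b where ab: "e = a + b" "a \<in> Poly_Mapping.keys g" "b \<in> Poly_Mapping.keys h"
      using keys_mult[of g h] by auto
    have "k \<le> total_degree a" using Suc.IH prod(1) ab(2) by blast
    moreover obtain v where "Poly_Mapping.lookup b v \<noteq> 0"
      using prod(2) ab(3) by (auto simp: max_ideal_eq vars_ideal_def)
    hence "1 \<le> total_degree b"
      by (simp add: total_degree_def Suc_le_eq sum_pos2[of UNIV v])
    ultimately show ?case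
      by (simp add: ab(1) total_degree_def lookup_add sum.distrib)
  next
    case (sum g h)
    thus ?case using keys_add[of g h] by auto
  qed
qed simp

lemma variable_power_mem_max_ideal_power_iff:
  "variable v ^ n \<in> ideal_power poly_ring max_ideal k \<longleftrightarrow> k \<le> n"
proof
  assume "variable v ^ n \<in> ideal_power poly_ring max_ideal k"
  from total_degree_ge_if_mem_max_ideal_power[OF this, of "Poly_Mapping.single v n"]
  show "k \<le> n" by (simp add: variable_power total_degree_def lookup_single when_def)
next
  assume "k \<le> n"
  thus "variable v ^ n \<in> ideal_power poly_ring max_ideal k"
    by (intro ideal_pow_mem_mono[OF ideal_power_ideal[OF max_ideal_ideal]
          power_mem_ideal_power[OF variable_mem_max_ideal]])
qed

lemma sat_max_ideal_power:
  "sat (ideal_power poly_ring (max_ideal :: ('v::{finite, linorder}, 'k::field) mpoly set) k) = k"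
proof -
  let ?M = "\<lambda>j. ideal_power poly_ring (max_ideal :: ('v, 'k) mpoly set) j"
  let ?C = "\<lambda>j. ideal_colon poly_ring (?M k) (?M j)"
  \<comment> \<open>From exponent \<open>k\<close> on the colon ideal is the whole ring, so the
    chain is stationary there; it remains to see that it does not stop earlier.\<close>
  have UNIV: "?C j = UNIV" if "k \<le> j" for j
    using ideal_power_antimono[OF max_ideal_ideal that] ideal_mult_mem[OF ideal_power_ideal[OF max_ideal_ideal]]
    by (auto simp: ideal_colon_def)
  show ?thesis unfolding sat_def
  proof (rule Least_equality)
    show "?C k = ?C (k + 1)" using UNIV[of k] UNIV[of "k + 1"] by (simp del: nat_pow_Suc)
  next
    fix j assume j: "?C j = ?C (j + 1)"
    show "k \<le> j"
    proof (rule ccontr)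
      assume "\<not> k \<le> j"
      \<comment> \<open>With \<open>m = k - j - 1\<close>, the power \<open>v ^ m\<close> of any
        variable separates the two colon ideals: it multiplies the power with exponent
        \<open>j + 1\<close> into \<open>?M k\<close>, but
        \<open>v ^ m * v ^ j = v ^ (k - 1)\<close> has too small a degree.\<close>
      then obtain m where m: "k = m + (j + 1)" by (metis add.commute le_Suc_ex not_less_eq_eq Suc_eq_plus1)
      fix v :: 'v
      have "variable v ^ m \<in> ?M m" using variable_power_mem_max_ideal_power_iff by blast
      hence "variable v ^ m \<in> ?C (j + 1)"
        unfolding ideal_colon_def m
        using mult_mem_ideal_power_add[OF max_ideal_ideal, of _ m _ "j + 1"] by fastforce
      hence "variable v ^ m \<in> ?C j" using j by simp
      moreover have "variable v ^ j \<in> ?M j" using variable_power_mem_max_ideal_power_iff by blast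
      ultimately have "variable v ^ (m + j) \<in> ?M k"
        by (simp add: ideal_colon_def power_add)
      thus False unfolding variable_power_mem_max_ideal_power_iff using m by simp
    qed
  qed
qed

section \<open>Symbolic powers, according to whether \<open>max_ideal\<close> is a minimal
  prime\<close>

text \<open>All variables are nilpotent modulo \<open>I\<close> and modulo its powers. Hence
  elements outside \<open>max_ideal\<close> are units modulo these powers, and localizing at the
  only minimal prime changes nothing.\<close>

lemma symbolic_power_eq_if_max_ideal_minimal:
  fixes I :: "('v::{finite, linorder}, 'k::field) mpoly set"
  assumes I: "monomial_ideal I" and m: "max_ideal \<in> minimal_primes poly_ring I"
  shows "max_ideal \<subseteq> ideal_radical poly_ring I"
    and "symbolic_power I k = ideal_power poly_ring I k"
proof -
  obtain E where E: "I = Idl\<^bsub>poly_ring\<^esub> (monomial ` E)"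
    using I by (auto simp: monomial_ideal_def)
  have ideal: "ideal I poly_ring" unfolding E by (rule genideal_ring_of_type_algebra_ideal)
  have pow: "\<exists>n. variable v ^ n \<in> I" for v
  proof -
    obtain n where "Poly_Mapping.single v n \<in> E"
      using variable_power_mem_if_max_ideal_minimal m unfolding E by blast
    hence "variable v ^ n \<in> I"
      unfolding E variable_power by (auto simp: genideal_def)
    thus ?thesis ..
  qed
  thus rad: "max_ideal \<subseteq> ideal_radical poly_ring I"
    by (simp add: max_ideal_subset_iff ideal_radical_ideal[OF ideal])
  let ?J = "ideal_power poly_ring I k"
  note J = ideal_power_ideal[OF ideal, of k]
  have "\<exists>n. variable v ^ n \<in> ?J" for v
  proof -
    obtain n where "variable v ^ n \<in> I" using pow by blast
    hence "(variable v ^ n) ^ k \<in> ?J" by (rule power_mem_ideal_power)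
    thus ?thesis by (auto simp flip: power_mult)
  qed
  hence radJ: "max_ideal \<subseteq> ideal_radical poly_ring ?J"
    by (simp add: max_ideal_subset_iff ideal_radical_ideal[OF J])
  have "P = max_ideal" if P: "P \<in> minimal_primes poly_ring I" for P
  proof -
    have prime: "primeideal P poly_ring" and "I \<subseteq> P" using P by (auto simp: minimal_primes_def)
    hence "variable v \<in> P" for v using pow[of v] primeideal_power_mem by blast
    thus ?thesis using prime
      by (intro max_ideal_maximal) (auto simp: max_ideal_subset_iff primeideal_ring_of_type_algebra_iff)
  qed
  with m have "minimal_primes poly_ring I = {max_ideal}" by blast
  hence "symbolic_power I k = local_contraction max_ideal ?J"
    by (simp add: symbolic_power_def)
  also have "\<dots> = {f. \<exists>s. s \<notin> max_ideal \<and> s * f \<in> ?J}"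
    by (rule local_contraction_eq[OF max_ideal_prime J])
  also have "\<dots> = ?J"
  proof (intro equalityI subsetI)
    fix f assume "f \<in> ?J"
    moreover have "1 \<notin> (max_ideal :: ('v, 'k) mpoly set)" by (simp add: mem_max_ideal_iff)
    ultimately show "f \<in> {f. \<exists>s. s \<notin> max_ideal \<and> s * f \<in> ?J}" by (auto intro!: exI[of _ 1])
  qed (auto dest: mem_if_mult_mem_and_radical_max_ideal[OF J radJ])
  finally show "symbolic_power I k = ?J" .
qed

lemma sat_symbolic_power_eq_0:
  fixes I :: "('v::{finite, linorder}, 'k::field) mpoly set"
  assumes I: "ideal I poly_ring" and m: "max_ideal \<notin> minimal_primes poly_ring I"
  shows "sat (symbolic_power I k) = 0"
proof (rule sat_eq_0I)
  fix f assume f: "\<And>g. g \<in> max_ideal \<Longrightarrow> f * g \<in> symbolic_power I k"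
  show "f \<in> symbolic_power I k"
    unfolding symbolic_power_def
  proof
    fix P assume P: "P \<in> minimal_primes poly_ring I"
    hence prime: "primeideal P poly_ring" by (simp add: minimal_primes_def)
    have "P \<noteq> max_ideal" using P m by auto
    \<comment> \<open>By maximality, \<open>max_ideal\<close> lies in no prime other than itself, so
      some \<open>g\<close> in it becomes a unit at \<open>P\<close>.\<close>
    hence "\<not> max_ideal \<subseteq> P"
      using prime max_ideal_maximal by (auto simp: primeideal_ring_of_type_algebra_iff)
    then obtain g where g: "g \<in> max_ideal" "g \<notin> P" by blast
    note lc = local_contraction_eq[OF prime ideal_power_ideal[OF I, of k]]
    have "f * g \<in> local_contraction P (ideal_power poly_ring I k)"
      using f[OF g(1)] P by (auto simp: symbolic_power_def)
    then obtain s where "s \<notin> P" "s * (f * g) \<in> ideal_power poly_ring I k"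
      unfolding lc by blast
    \<comment> \<open>The factor \<open>g\<close> moves to the denominator: \<open>s * g\<close>
      avoids the prime \<open>P\<close> and witnesses that \<open>f\<close> itself lies in the
      contraction.\<close>
    moreover from this have "s * g \<notin> P"
      using g prime by (auto simp: primeideal_ring_of_type_algebra_iff)
    ultimately have "s * g \<notin> P \<and> (s * g) * f \<in> ideal_power poly_ring I k"
      by (simp add: ac_simps)
    thus "f \<in> local_contraction P (ideal_power poly_ring I k)"
      unfolding lc by blast
  qed
qed

theorem corollary2p4:
  fixes I :: "('v::{finite, linorder}, 'k::field) mpoly set"
    and q :: "nat \<Rightarrow> ('v, 'k) mpoly set"
    and r k :: nat
  assumes "monomial_ideal I" and "k \<ge> 1"
  shows "(primary_decomposition poly_ring I r q \<longrightarrow>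
            sat (symbolic_power I k) \<le>
              Max {sat (ideal_power poly_ring (q i) k) | i.
                     i \<in> {1..r} \<and> ideal_radical poly_ring (q i) \<in> minimal_primes poly_ring I})
       \<and> (squarefree_monomial_ideal I \<longrightarrow>
            sat (symbolic_power I k) = (if I = max_ideal then k else 0))"
proof (cases "max_ideal \<in> minimal_primes poly_ring I")
  case False
  obtain E where "I = Idl\<^bsub>poly_ring\<^esub> (monomial ` E)"
    using assms(1) by (auto simp: monomial_ideal_def)
  hence "ideal I poly_ring" using genideal_ring_of_type_algebra_ideal by simp
  hence "sat (symbolic_power I k) = 0" using False by (rule sat_symbolic_power_eq_0)
  moreover have "I \<noteq> max_ideal" using False max_ideal_mem_minimal_primes by metis
  \<comment> \<open>The bound holds for any value of \<open>Max\<close>, including the case of the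
    unit ideal with \<open>r = 0\<close>, where the set is empty. In the squarefree claim the second
    branch applies, because \<open>max_ideal\<close> is minimal over itself.\<close>
  ultimately show ?thesis by simp
next
  case True
  note rad = symbolic_power_eq_if_max_ideal_minimal(1)[OF assms(1) True]
  note symb = symbolic_power_eq_if_max_ideal_minimal(2)[OF assms(1) True, of k]
  have I_sub: "I \<subseteq> max_ideal" using True by (simp add: minimal_primes_def)
  show ?thesis
  proof (intro conjI impI)
    assume "primary_decomposition poly_ring I r q"
    hence prim: "\<And>i. i \<in> {1..r} \<Longrightarrow> primary_ideal poly_ring (q i)"
      and I_eq: "I = (\<Inter>i\<in>{1..r}. q i)"
      and inj: "inj_on (\<lambda>i. ideal_radical poly_ring (q i)) {1..r}"
      by (auto simp: primary_decomposition_def)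
    \<comment> \<open>Each component contains \<open>I\<close>, so its radical contains that of
      \<open>I\<close> and hence \<open>max_ideal\<close>; being proper, it equals
      \<open>max_ideal\<close>.\<close>
    have radq: "ideal_radical poly_ring (q i) = max_ideal" if i: "i \<in> {1..r}" for i
    proof (rule max_ideal_maximal)
      have q: "ideal (q i) poly_ring" "q i \<noteq> UNIV"
        using prim[OF i] by (auto simp: primary_ideal_def)
      show "ideal (ideal_radical poly_ring (q i)) poly_ring" by (rule ideal_radical_ideal[OF q(1)])
      have "I \<subseteq> q i" using I_eq i by blast
      thus "max_ideal \<subseteq> ideal_radical poly_ring (q i)"
        using rad by fastforce
      show "1 \<notin> ideal_radical poly_ring (q i)"
        using q ideal_eq_UNIV_iff[OF q(1)] by auto
    qed
    \<comment> \<open>An empty intersection would be the whole ring, and two components would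
      violate the distinctness of the radicals.\<close>
    have "r \<noteq> 0"
    proof
      assume "r = 0"
      hence "1 \<in> I" using I_eq by simp
      thus False using I_sub by (auto simp: mem_max_ideal_iff)
    qed
    moreover have "\<not> 2 \<le> r"
      using inj_onD[OF inj, of 1 2] radq[of 1] radq[of 2] by auto
    ultimately have r: "r = 1" by simp
    hence "I = q 1" using I_eq by simp
    moreover have "{sat (ideal_power poly_ring (q i) k) | i.
        i \<in> {1..r} \<and> ideal_radical poly_ring (q i) \<in> minimal_primes poly_ring I} =
      {sat (ideal_power poly_ring (q 1) k)}"
      using r radq[of 1] True by auto
    ultimately show "sat (symbolic_power I k) \<le>
        Max {sat (ideal_power poly_ring (q i) k) | i.
          i \<in> {1..r} \<and> ideal_radical poly_ring (q i) \<in> minimal_primes poly_ring I}"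
      using symb by simp
  next
    assume "squarefree_monomial_ideal I"
    then obtain E where sqf: "\<And>e v. e \<in> E \<Longrightarrow> Poly_Mapping.lookup e v \<le> 1"
      and E: "I = Idl\<^bsub>poly_ring\<^esub> (monomial ` E)"
      by (auto simp: squarefree_monomial_ideal_def)
    have "variable v \<in> I" for v
    proof -
      obtain n where n: "Poly_Mapping.single v n \<in> E"
        using variable_power_mem_if_max_ideal_minimal True unfolding E by blast
      hence mem: "variable v ^ n \<in> I"
        unfolding E variable_power by (auto simp: genideal_def)
      \<comment> \<open>Exponent 0 would put 1 into \<open>I\<close>; together with squarefreeness
        this forces exponent 1.\<close>
      have "n \<noteq> 0"
      proof
        assume "n = 0"
        hence "(1 :: ('v, 'k) mpoly) \<in> max_ideal" using mem I_sub by auto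
        thus False by (simp add: mem_max_ideal_iff)
      qed
      moreover have "n \<le> 1" using sqf[OF n, of v] by simp
      ultimately have "n = 1" by simp
      thus ?thesis using mem by simp
    qed
    hence "max_ideal \<subseteq> I"
      by (simp add: max_ideal_subset_iff E genideal_ring_of_type_algebra_ideal)
    hence "I = max_ideal" using I_sub by blast
    thus "sat (symbolic_power I k) = (if I = max_ideal then k else 0)"
      using symb sat_max_ideal_power by simp
  qed
qed

end
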